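(* Let $A$ be an atomic domain, $r>1$ an integer, and $S\subseteq A$ a saturated multiplicative set such that every nonunit element of $S$ is a product of $r$-good atoms of $A$. If the fraction ring $A_S$ is an $r$-congruence half-factorial domain ($r$-CHFD), then $A$ is an $r$-CHFD.
   Context: Domain means (commutative) integral domain. An atom (irreducible element) of a domain $A$ is a nonzero nonunit that is not a product of two nonunits of $A$. $A$ is atomic if every nonzero nonunit of $A$ is a product of finitely many atoms. For an integer $r>1$, an $r$-congruence half-factorial domain ($r$-CHFD) is an atomic domain $A$ such that for each nonzero nonunit $x\in A$ the lengths (numbers of factors) of all factorizations of $x$ into atoms are congruent modulo $r$. A multiplicative set $S$ (closed under multiplication, containing $1$) is saturated if every divisor in $A$ of an element of $S$ lies in $S$. $A_S$ denotes the localization of $A$ at $S$. Let $A$ be an atomic domain and $r>1$ an integer. An atomic equality is an equality $a_1\cdots a_n=b_1\cdots b_m$ in which all factors $a_i,b_j$ are atoms of $A$ ($n,m\ge 1$). It is $r$-balanced if $n\equiv m \pmod r$ and $r$-unbalanced otherwise. It is irredundant if no proper subproduct of the $a$'s is associated to a proper subproduct of the $b$'s, i.e. $\prod_{i\in I}a_i$ is not associated (equal up to a unit factor of $A$) to $\prod_{j\in J}b_j$ for all nonempty proper subsets $I\subsetneq\{1,\dots,n\}$, $J\subsetneq\{1,\dots,m\}$. An $r$-bad atom is an atom that appears (as one of the $a_i$ or $b_j$) in some irredundant $r$-unbalanced atomic equality. An $r$-good atom is an atom that is not $r$-bad. *)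

theory Defs
  imports "HOL-Algebra.Algebra"
begin

section \<open>Localization of a commutative ring at a multiplicative set\<close>

definition fraction_rel :: "('a, 'b) ring_scheme \<Rightarrow> 'a set \<Rightarrow> (('a \<times> 'a) \<times> ('a \<times> 'a)) set"
  where "fraction_rel R S =
    {((a, s), (b, t)). a \<in> carrier R \<and> s \<in> S \<and> b \<in> carrier R \<and> t \<in> S \<and>
       (\<exists>u\<in>S. u \<otimes>\<^bsub>R\<^esub> (a \<otimes>\<^bsub>R\<^esub> t) = u \<otimes>\<^bsub>R\<^esub> (b \<otimes>\<^bsub>R\<^esub> s))}"

definition fraction :: "('a, 'b) ring_scheme \<Rightarrow> 'a set \<Rightarrow> 'a \<Rightarrow> 'a \<Rightarrow> ('a \<times> 'a) set"
  where "fraction R S a s = fraction_rel R S `` {(a, s)}"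

text \<open>The unions over representatives in the ring operations are the usual way of lifting an
  operation to a quotient: all members of such a union coincide (see \<open>localization_add\<close> and
  \<open>localization_mult\<close> below).\<close>

definition localization :: "('a, 'b) ring_scheme \<Rightarrow> 'a set \<Rightarrow> ('a \<times> 'a) set ring"
  where "localization R S =
    \<lparr> carrier = (carrier R \<times> S) // fraction_rel R S,
      monoid.mult = (\<lambda>P Q. \<Union>(a, s)\<in>P. \<Union>(b, t)\<in>Q. fraction R S (a \<otimes>\<^bsub>R\<^esub> b) (s \<otimes>\<^bsub>R\<^esub> t)),
      one = fraction R S \<one>\<^bsub>R\<^esub> \<one>\<^bsub>R\<^esub>,
      ring.zero = fraction R S \<zero>\<^bsub>R\<^esub> \<one>\<^bsub>R\<^esub>,
      add = (\<lambda>P Q. \<Union>(a, s)\<in>P. \<Union>(b, t)\<in>Q.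
               fraction R S ((a \<otimes>\<^bsub>R\<^esub> t) \<oplus>\<^bsub>R\<^esub> (b \<otimes>\<^bsub>R\<^esub> s)) (s \<otimes>\<^bsub>R\<^esub> t)) \<rparr>"

definition saturated :: "('a, 'b) ring_scheme \<Rightarrow> 'a set \<Rightarrow> bool"
  where "saturated R S \<longleftrightarrow> (\<forall>s\<in>S. \<forall>a\<in>carrier R. a divides\<^bsub>R\<^esub> s \<longrightarrow> a \<in> S)"

context
  fixes R (structure) and S
  assumes R: "cring R" and S: "submonoid S R"
begin

interpretation cring R by (rule R)
interpretation S: submonoid S R by (rule S)

lemma S_carrier: "s \<in> S \<Longrightarrow> s \<in> carrier R"
  using S.subset by blast

lemma equiv_fraction_rel: "equiv (carrier R \<times> S) (fraction_rel R S)"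
proof (rule equivI)
  show "fraction_rel R S \<subseteq> (carrier R \<times> S) \<times> (carrier R \<times> S)"
    by (auto simp: fraction_rel_def)
  show "refl_on (carrier R \<times> S) (fraction_rel R S)"
    by (auto simp: fraction_rel_def refl_on_def intro: S.one_closed)
  show "sym (fraction_rel R S)"
    by (rule symI) (clarsimp simp: fraction_rel_def, metis)
  show "trans (fraction_rel R S)"
  proof (rule transI, clarsimp simp: fraction_rel_def)
    fix a s b t c v u w
    assume H: "a \<in> carrier R" "s \<in> S" "b \<in> carrier R" "t \<in> S" "c \<in> carrier R" "v \<in> S"
      "u \<in> S" "w \<in> S"
      and e1: "u \<otimes> (a \<otimes> t) = u \<otimes> (b \<otimes> s)" and e2: "w \<otimes> (b \<otimes> v) = w \<otimes> (c \<otimes> t)"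
    note C = H(1,3,5) H(2,4,6-8)[THEN S_carrier]
    have "(u \<otimes> w \<otimes> t) \<otimes> (a \<otimes> v) = (w \<otimes> v) \<otimes> (u \<otimes> (a \<otimes> t))"
      using C by (simp add: m_ac)
    also have "\<dots> = (u \<otimes> s) \<otimes> (w \<otimes> (b \<otimes> v))"
      unfolding e1 using C by (simp add: m_ac)
    also have "\<dots> = (u \<otimes> w \<otimes> t) \<otimes> (c \<otimes> s)"
      unfolding e2 using C by (simp add: m_ac)
    finally show "\<exists>u\<in>S. u \<otimes> (a \<otimes> v) = u \<otimes> (c \<otimes> s)"
      using H by (intro bexI[of _ "u \<otimes> w \<otimes> t"]) auto
  qed
qed

lemma fraction_eq_iff:
  assumes "a \<in> carrier R" "s \<in> S" "b \<in> carrier R" "t \<in> S"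
  shows "fraction R S a s = fraction R S b t \<longleftrightarrow> (\<exists>u\<in>S. u \<otimes> (a \<otimes> t) = u \<otimes> (b \<otimes> s))"
  using eq_equiv_class_iff[OF equiv_fraction_rel, of "(a, s)" "(b, t)"] assms
  by (simp add: fraction_def) (simp add: fraction_rel_def)

lemma localization_carrier:
  "carrier (localization R S) = {fraction R S a s | a s. a \<in> carrier R \<and> s \<in> S}"
  by (auto simp: localization_def quotient_def fraction_def)

lemma localization_one: "\<one>\<^bsub>localization R S\<^esub> = fraction R S \<one> \<one>"
  and localization_zero: "\<zero>\<^bsub>localization R S\<^esub> = fraction R S \<zero> \<one>"
  by (simp_all add: localization_def)

lemma localization_mult:
  assumes "a \<in> carrier R" "s \<in> S" "b \<in> carrier R" "t \<in> S"
  shows "fraction R S a s \<otimes>\<^bsub>localization R S\<^esub> fraction R S b t = fraction R S (a \<otimes> b) (s \<otimes> t)"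
proof -
  have "congruent2 (fraction_rel R S) (fraction_rel R S)
          (\<lambda>p q. case p of (a, s) \<Rightarrow> case q of (b, t) \<Rightarrow> fraction R S (a \<otimes> b) (s \<otimes> t))"
  proof (rule congruent2I', clarsimp simp: fraction_rel_def)
    fix a s a' s' b t b' t' u w
    assume H: "a \<in> carrier R" "a' \<in> carrier R" "b \<in> carrier R" "b' \<in> carrier R"
      "s \<in> S" "s' \<in> S" "t \<in> S" "t' \<in> S" "u \<in> S" "w \<in> S"
      and e1: "u \<otimes> (a \<otimes> s') = u \<otimes> (a' \<otimes> s)" and e2: "w \<otimes> (b \<otimes> t') = w \<otimes> (b' \<otimes> t)"
    note C = H(1-4) H(5-10)[THEN S_carrier]
    have "(u \<otimes> w) \<otimes> ((a \<otimes> b) \<otimes> (s' \<otimes> t')) = (u \<otimes> (a \<otimes> s')) \<otimes> (w \<otimes> (b \<otimes> t'))"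
      using C by (simp add: m_ac)
    also have "\<dots> = (u \<otimes> w) \<otimes> ((a' \<otimes> b') \<otimes> (s \<otimes> t))"
      unfolding e1 e2 using C by (simp add: m_ac)
    finally show "fraction R S (a \<otimes> b) (s \<otimes> t) = fraction R S (a' \<otimes> b') (s' \<otimes> t')"
      using H C by (subst fraction_eq_iff) (blast intro: m_closed S.m_closed)+
  qed
  from UN_equiv_class2[OF equiv_fraction_rel equiv_fraction_rel this, of "(a, s)" "(b, t)"] assms
  show ?thesis
    by (simp add: localization_def fraction_def[of R S a s] fraction_def[of R S b t] split_def)
qed

lemma localization_add:
  assumes "a \<in> carrier R" "s \<in> S" "b \<in> carrier R" "t \<in> S"
  shows "fraction R S a s \<oplus>\<^bsub>localization R S\<^esub> fraction R S b t =
         fraction R S ((a \<otimes> t) \<oplus> (b \<otimes> s)) (s \<otimes> t)"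
proof -
  have "congruent2 (fraction_rel R S) (fraction_rel R S)
          (\<lambda>p q. case p of (a, s) \<Rightarrow> case q of (b, t) \<Rightarrow>
             fraction R S ((a \<otimes> t) \<oplus> (b \<otimes> s)) (s \<otimes> t))"
  proof (rule congruent2I', clarsimp simp: fraction_rel_def)
    fix a s a' s' b t b' t' u w
    assume H: "a \<in> carrier R" "a' \<in> carrier R" "b \<in> carrier R" "b' \<in> carrier R"
      "s \<in> S" "s' \<in> S" "t \<in> S" "t' \<in> S" "u \<in> S" "w \<in> S"
      and e1: "u \<otimes> (a \<otimes> s') = u \<otimes> (a' \<otimes> s)" and e2: "w \<otimes> (b \<otimes> t') = w \<otimes> (b' \<otimes> t)"
    note C = H(1-4) H(5-10)[THEN S_carrier]
    have split: "(u \<otimes> w) \<otimes> ((x \<oplus> y) \<otimes> z) = (u \<otimes> w) \<otimes> (x \<otimes> z) \<oplus> (u \<otimes> w) \<otimes> (y \<otimes> z)"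
      if "x \<in> carrier R" "y \<in> carrier R" "z \<in> carrier R" for x y z
      using that C by (simp add: l_distr r_distr)
    have "(u \<otimes> w) \<otimes> ((a \<otimes> t) \<otimes> (s' \<otimes> t')) = (u \<otimes> (a \<otimes> s')) \<otimes> (w \<otimes> (t \<otimes> t'))"
      using C by (simp add: m_ac)
    also have "\<dots> = (u \<otimes> w) \<otimes> ((a' \<otimes> t') \<otimes> (s \<otimes> t))"
      unfolding e1 using C by (simp add: m_ac)
    finally have 1: "(u \<otimes> w) \<otimes> ((a \<otimes> t) \<otimes> (s' \<otimes> t')) = \<dots>" .
    have "(u \<otimes> w) \<otimes> ((b \<otimes> s) \<otimes> (s' \<otimes> t')) = (w \<otimes> (b \<otimes> t')) \<otimes> (u \<otimes> (s \<otimes> s'))"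
      using C by (simp add: m_ac)
    also have "\<dots> = (u \<otimes> w) \<otimes> ((b' \<otimes> s') \<otimes> (s \<otimes> t))"
      unfolding e2 using C by (simp add: m_ac)
    finally have 2: "(u \<otimes> w) \<otimes> ((b \<otimes> s) \<otimes> (s' \<otimes> t')) = \<dots>" .
    have e: "(u \<otimes> w) \<otimes> (((a \<otimes> t) \<oplus> (b \<otimes> s)) \<otimes> (s' \<otimes> t')) =
          (u \<otimes> w) \<otimes> (((a' \<otimes> t') \<oplus> (b' \<otimes> s')) \<otimes> (s \<otimes> t))"
      by (simp only: split 1 2 C m_closed)
    show "fraction R S ((a \<otimes> t) \<oplus> (b \<otimes> s)) (s \<otimes> t) =
                  fraction R S ((a' \<otimes> t') \<oplus> (b' \<otimes> s')) (s' \<otimes> t')"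
    proof (subst fraction_eq_iff)
      have "u \<otimes> w \<in> S" using H by simp
      with e show "\<exists>u\<in>S. u \<otimes> (((a \<otimes> t) \<oplus> (b \<otimes> s)) \<otimes> (s' \<otimes> t')) =
                     u \<otimes> (((a' \<otimes> t') \<oplus> (b' \<otimes> s')) \<otimes> (s \<otimes> t))"
        by blast
    qed (use H C in simp_all)
  qed
  from UN_equiv_class2[OF equiv_fraction_rel equiv_fraction_rel this, of "(a, s)" "(b, t)"] assms
  show ?thesis
    by (simp add: localization_def fraction_def[of R S a s] fraction_def[of R S b t] split_def)
qed

end


section \<open>Atoms, atomic domains and congruence half-factorial domains\<close>

text \<open>\<open>irreducible\<close> alone would count \<open>\<zero>\<close> as an atom of a field; \<open>ring_irreducible\<close> excludes it.\<close>

definition atoms :: "('a, 'b) ring_scheme \<Rightarrow> 'a set"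
  where "atoms R = {a \<in> carrier R. ring_irreducible\<^bsub>R\<^esub> a}"

lemma (in domain) atoms_iff:
  "a \<in> atoms R \<longleftrightarrow> a \<in> carrier R \<and> a \<noteq> \<zero> \<and> a \<notin> Units R \<and>
     \<not> (\<exists>b\<in>carrier R - Units R. \<exists>c\<in>carrier R - Units R. a = b \<otimes> c)"
proof
  assume "a \<in> atoms R"
  then have a: "a \<in> carrier R" "ring_irreducible a"
    by (auto simp: atoms_def)
  show "a \<in> carrier R \<and> a \<noteq> \<zero> \<and> a \<notin> Units R \<and>
     \<not> (\<exists>b\<in>carrier R - Units R. \<exists>c\<in>carrier R - Units R. a = b \<otimes> c)"
    using a(1) ring_irreducibleE(1,4)[OF a] ring_irreducibleE(5)[OF a] by auto
next
  assume a: "a \<in> carrier R \<and> a \<noteq> \<zero> \<and> a \<notin> Units R \<and>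
     \<not> (\<exists>b\<in>carrier R - Units R. \<exists>c\<in>carrier R - Units R. a = b \<otimes> c)"
  have "ring_irreducible a"
    by (rule ring_irreducibleI) (use a in auto)
  with a show "a \<in> atoms R"
    by (simp add: atoms_def)
qed

abbreviation list_prod :: "('a, 'b) ring_scheme \<Rightarrow> 'a list \<Rightarrow> 'a"
  where "list_prod R xs \<equiv> foldr (\<otimes>\<^bsub>R\<^esub>) xs \<one>\<^bsub>R\<^esub>"

definition atomic_factorization :: "('a, 'b) ring_scheme \<Rightarrow> 'a list \<Rightarrow> 'a \<Rightarrow> bool"
  where "atomic_factorization R as x \<longleftrightarrow> set as \<subseteq> atoms R \<and> list_prod R as = x"

definition atomic_domain :: "('a, 'b) ring_scheme \<Rightarrow> bool"
  where "atomic_domain R \<longleftrightarrow> domain R \<and>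
    (\<forall>x \<in> carrier R - Units R - {\<zero>\<^bsub>R\<^esub>}. \<exists>as. atomic_factorization R as x)"

definition CHFD :: "nat \<Rightarrow> ('a, 'b) ring_scheme \<Rightarrow> bool"
  where "CHFD r R \<longleftrightarrow> atomic_domain R \<and>
    (\<forall>x \<in> carrier R - Units R - {\<zero>\<^bsub>R\<^esub>}. \<forall>as bs.
       atomic_factorization R as x \<and> atomic_factorization R bs x \<longrightarrow>
       length as mod r = length bs mod r)"


section \<open>Atomic equalities and good atoms\<close>

definition atomic_equality :: "('a, 'b) ring_scheme \<Rightarrow> 'a list \<Rightarrow> 'a list \<Rightarrow> bool"
  where "atomic_equality R as bs \<longleftrightarrow>
    as \<noteq> [] \<and> bs \<noteq> [] \<and> set as \<subseteq> atoms R \<and> set bs \<subseteq> atoms R \<and>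
    list_prod R as = list_prod R bs"

definition balanced :: "nat \<Rightarrow> 'a list \<Rightarrow> 'a list \<Rightarrow> bool"
  where "balanced r as bs \<longleftrightarrow> length as mod r = length bs mod r"

text \<open>\<open>I\<close> and \<open>J\<close> are sets of positions, so repeated atoms are told apart. In a domain
  \<open>\<sim>\<close> is equality up to a unit factor (\<open>domain.ring_associated_iff\<close>).\<close>

definition irredundant :: "('a, 'b) ring_scheme \<Rightarrow> 'a list \<Rightarrow> 'a list \<Rightarrow> bool"
  where "irredundant R as bs \<longleftrightarrow>
    (\<forall>I J. I \<noteq> {} \<and> I \<subset> {..<length as} \<and> J \<noteq> {} \<and> J \<subset> {..<length bs} \<longrightarrow>
       \<not> list_prod R (nths as I) \<sim>\<^bsub>R\<^esub> list_prod R (nths bs J))"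

definition bad_atom :: "nat \<Rightarrow> ('a, 'b) ring_scheme \<Rightarrow> 'a \<Rightarrow> bool"
  where "bad_atom r R a \<longleftrightarrow>
    (\<exists>as bs. atomic_equality R as bs \<and> irredundant R as bs \<and> \<not> balanced r as bs \<and>
       a \<in> set as \<union> set bs)"

definition good_atom :: "nat \<Rightarrow> ('a, 'b) ring_scheme \<Rightarrow> 'a \<Rightarrow> bool"
  where "good_atom r R a \<longleftrightarrow> a \<in> atoms R \<and> \<not> bad_atom r R a"

end

(* Since atoms lying in S are good, splitting a redundant unbalanced equality until an irredundant
   unbalanced part remains leaves only bad atoms, hence only atoms outside S. If all atoms outside S
   that occur remain atoms in A_S, this contradicts the congruence in A_S. A general atom a
   is reduced to this case by lifting a factorization of a/1 in A_S to an equality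
   a l_1 ... l_j = n_1 ... n_k up to a unit, where each l_i lies in S and each n_i lies in S or stays
   an atom in A_S. In an irredundant unbalanced part of it, a would be the only atom on the left,
   which is impossible; so 1 + j and k agree modulo r. *)

theory Submission
  imports Defs
begin

section \<open>Products of atoms in a domain\<close>

context domain
begin

lemma atoms_carrier: "a \<in> atoms R \<Longrightarrow> a \<in> carrier R"
  by (simp add: atoms_def)

lemma list_prod_closed: "set as \<subseteq> carrier R \<Longrightarrow> list_prod R as \<in> carrier R"
  by (induction as) auto

lemma list_prod_append:
  "set as \<subseteq> carrier R \<Longrightarrow> set bs \<subseteq> carrier R \<Longrightarrow>
     list_prod R (as @ bs) = list_prod R as \<otimes> list_prod R bs"
  by (induction as) (auto simp: list_prod_closed m_assoc)

lemma list_prod_atoms_closed: "set as \<subseteq> atoms R \<Longrightarrow> list_prod R as \<in> carrier R"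
  by (rule list_prod_closed) (auto dest: atoms_carrier)

lemma list_prod_atoms_append:
  "set as \<subseteq> atoms R \<Longrightarrow> set bs \<subseteq> atoms R \<Longrightarrow>
     list_prod R (as @ bs) = list_prod R as \<otimes> list_prod R bs"
  by (rule list_prod_append) (auto dest: atoms_carrier)

lemma list_prod_atoms_nonzero: "set as \<subseteq> atoms R \<Longrightarrow> list_prod R as \<noteq> \<zero>"
  by (induction as) (auto simp: list_prod_atoms_closed integral_iff atoms_iff)

lemma zero_not_Units: "\<zero> \<notin> Units R"
proof
  assume "\<zero> \<in> Units R"
  then have "\<zero> \<otimes> inv \<zero> = \<one>" "inv \<zero> \<in> carrier R" by (rule Units_r_inv, rule Units_inv_closed)
  then show False by simp
qed

lemma unit_factor_left:
  assumes "a \<in> carrier R" "b \<in> carrier R" "a \<otimes> b \<in> Units R"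
  shows "a \<in> Units R"
  using assms by (metis unit_factor)

lemma list_prod_atoms_Units:
  assumes "set as \<subseteq> atoms R"
  shows "list_prod R as \<in> Units R \<longleftrightarrow> as = []"
proof (cases as)
  case (Cons a as')
  then show ?thesis
    using assms unit_factor_left[of a "list_prod R as'"] list_prod_atoms_closed[of as']
    by (auto simp: atoms_iff)
qed simp

lemma associated_Units: "a \<sim> b \<Longrightarrow> a \<in> Units R \<Longrightarrow> b \<in> carrier R \<Longrightarrow> b \<in> Units R"
  by (metis Units_closed Units_cong associated_sym)

lemma associated_mult:
  assumes "a \<sim> b" "c \<sim> d" "a \<in> carrier R" "b \<in> carrier R" "c \<in> carrier R" "d \<in> carrier R"
  shows "a \<otimes> c \<sim> b \<otimes> d"
  using assms by (meson associated_trans m_closed mult_cong_l mult_cong_r)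

text \<open>Writing \<open>a\<close> as \<open>u\<close> times \<open>b\<close> and
  \<open>a \<otimes> c\<close> as \<open>v\<close> times \<open>b \<otimes> d\<close> with units
  \<open>u\<close>, \<open>v\<close>, cancellation of \<open>b\<close> leaves
  \<open>u \<otimes> c = v \<otimes> d\<close>. This lets complementary subproducts inherit
  association.\<close>

lemma associated_mult_cancel:
  assumes "a \<otimes> c \<sim> b \<otimes> d" "a \<sim> b" "b \<noteq> \<zero>"
    and "a \<in> carrier R" "b \<in> carrier R" "c \<in> carrier R" "d \<in> carrier R"
  shows "c \<sim> d"
proof -
  obtain u where u: "u \<in> Units R" "a = u \<otimes> b"
    using assms ring_associated_iff by blast
  obtain v where v: "v \<in> Units R" "a \<otimes> c = v \<otimes> (b \<otimes> d)"
    using assms ring_associated_iff by (metis m_closed)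
  have uc: "u \<in> carrier R" and vc: "v \<in> carrier R"
    using u v by auto
  have "b \<otimes> (u \<otimes> c) = b \<otimes> (v \<otimes> d)"
    using u(2) v(2) uc vc assms by (simp add: m_ac)
  then have "u \<otimes> c = v \<otimes> d"
    using assms uc vc by (meson m_closed m_lcancel)
  moreover have "u \<otimes> c \<sim> c" "v \<otimes> d \<sim> d"
    using assms(6,7) u(1) v(1) uc vc ring_associated_iff m_closed by blast+
  ultimately show ?thesis
    using assms uc vc by (metis associated_sym associated_trans)
qed

text \<open>Two or more atoms would split \<open>a\<close> into two nonunits, since a nonempty
  product of atoms is a nonunit; an empty product would make \<open>a\<close> a unit.\<close>

lemma list_prod_associated_atom:
  assumes as: "set as \<subseteq> atoms R" and a: "a \<in> atoms R" and eq: "a \<sim> list_prod R as"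
  obtains b where "as = [b]" "a \<sim> b"
proof (cases as)
  case Nil
  then have "a \<in> Units R"
    using eq a associated_Units[of \<one> a] associated_sym by (auto simp: atoms_iff)
  with a show ?thesis by (simp add: atoms_iff)
next
  case (Cons b bs)
  show ?thesis
  proof (cases bs)
    case Nil
    have "b \<in> carrier R" using as Cons by (auto simp: atoms_iff)
    then show ?thesis using that[of b] Nil Cons eq by simp
  next
    case (Cons c cs)
    have at: "b \<in> atoms R" "set bs \<subseteq> atoms R"
      using as \<open>as = b # bs\<close> by auto
    have bc: "b \<in> carrier R" "b \<notin> Units R" using at by (auto simp: atoms_iff)
    have pc: "list_prod R bs \<in> carrier R" "list_prod R bs \<notin> Units R"
      using list_prod_atoms_closed[OF at(2)] list_prod_atoms_Units[OF at(2)] Cons by (auto simp del: foldr.simps)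
    obtain u where u: "u \<in> Units R" "a = u \<otimes> (b \<otimes> list_prod R bs)"
      using eq ring_associated_iff[of a "list_prod R as"] as a \<open>as = b # bs\<close>
        list_prod_atoms_closed[of as] by (auto simp: atoms_iff)
    \<comment> \<open>The unit joins \<open>b\<close>; both \<open>u \<otimes> b\<close> and the
      nonempty remainder are nonunits, against irreducibility of \<open>a\<close>.\<close>
    have "a = (u \<otimes> b) \<otimes> list_prod R bs"
      using u Units_closed[OF u(1)] bc pc by (simp add: m_assoc)
    moreover have ub: "u \<otimes> b \<in> carrier R"
      using Units_closed[OF u(1)] bc by simp
    moreover have "u \<otimes> b \<notin> Units R"
      using u(1) bc unit_factor_left[of b u] m_comm[of b u] by auto
    ultimately show ?thesis using a pc unfolding atoms_iff by blast
  qed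
qed

text \<open>A splitting of \<open>u \<otimes> a\<close> into nonunits, multiplied by
  \<open>inv u\<close>, would split \<open>a\<close>.\<close>

lemma Units_mult_atom:
  assumes u: "u \<in> Units R" and a: "a \<in> atoms R"
  shows "u \<otimes> a \<in> atoms R"
proof -
  have ac: "a \<in> carrier R" and uc: "u \<in> carrier R"
    using u a by (auto simp: atoms_iff)
  have iu: "inv u \<in> Units R" "inv u \<in> carrier R" using u by auto
  have inv: "inv u \<otimes> (u \<otimes> a) = a"
    using u uc ac iu by (simp flip: m_assoc)
  have "u \<otimes> a \<noteq> \<zero>"
    using inv a iu by (auto simp: atoms_iff)
  moreover have "u \<otimes> a \<notin> Units R"
    using a uc ac unit_factor_left[of a u] m_comm by (auto simp: atoms_iff)
  moreover have "\<not> (\<exists>b\<in>carrier R - Units R. \<exists>c\<in>carrier R - Units R. u \<otimes> a = b \<otimes> c)"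
  proof (intro notI, elim bexE)
    fix b c assume b: "b \<in> carrier R - Units R" and c: "c \<in> carrier R - Units R"
      and eq: "u \<otimes> a = b \<otimes> c"
    have "a = (inv u \<otimes> b) \<otimes> c"
      using inv eq b c iu by (auto simp: m_assoc)
    moreover have "inv u \<otimes> b \<in> carrier R - Units R"
      using b iu m_comm unit_factor_left[of b "inv u"] by auto
    ultimately show False using a c unfolding atoms_iff by blast
  qed
  ultimately show ?thesis using uc ac by (simp add: atoms_iff)
qed

text \<open>The unit relating the two products is absorbed into the atom \<open>b\<close>, for which
  the right list has to be nonempty. This turns association into the exact equality that
  \<open>CHFD\<close> and \<open>bad_atom\<close> speak of.\<close>

lemma associated_list_prod_adjust:
  assumes "set as \<subseteq> atoms R" "set (b # bs) \<subseteq> atoms R"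
    and "list_prod R as \<sim> list_prod R (b # bs)"
  obtains c where "c \<in> atoms R" "c \<sim> b" "list_prod R as = list_prod R (c # bs)"
proof -
  obtain u where u: "u \<in> Units R" "list_prod R as = u \<otimes> list_prod R (b # bs)"
    using assms ring_associated_iff list_prod_atoms_closed by meson
  have "b \<in> carrier R" "list_prod R bs \<in> carrier R"
    using assms(2) list_prod_atoms_closed by (auto simp: atoms_iff)
  then show ?thesis
    using u assms(2) Units_mult_atom[of u b] ring_associated_iff[of "u \<otimes> b" b]
    by (intro that[of "u \<otimes> b"]) (auto simp: m_assoc)
qed

lemma associated_list_prod_Nil_iff:
  assumes "set as \<subseteq> atoms R" "set bs \<subseteq> atoms R" "list_prod R as \<sim> list_prod R bs"
  shows "as = [] \<longleftrightarrow> bs = []"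
  using assms list_prod_atoms_Units list_prod_atoms_closed associated_Units associated_sym by metis

text \<open>\<open>CHFD\<close> compares factorizations of one and the same nonunit. Absorbing the
  unit into an atom reaches associated products; unit products are handled apart, as only the empty
  list yields one.\<close>

lemma CHFD_associated:
  assumes "CHFD r R" "set as \<subseteq> atoms R" "set bs \<subseteq> atoms R" "list_prod R as \<sim> list_prod R bs"
  shows "balanced r as bs"
proof (cases bs)
  case Nil
  then show ?thesis using associated_list_prod_Nil_iff[OF assms(2-4)] by (simp add: balanced_def)
next
  case (Cons b bs')
  then obtain c where c: "c \<in> atoms R" "list_prod R as = list_prod R (c # bs')"
    using associated_list_prod_adjust assms by metis
  have "as \<noteq> []" using associated_list_prod_Nil_iff[OF assms(2-4)] Cons by simp
  then have "list_prod R as \<in> carrier R - Units R - {\<zero>}"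
    using list_prod_atoms_closed list_prod_atoms_Units list_prod_atoms_nonzero assms(2) by auto
  moreover have "set (c # bs') \<subseteq> atoms R" using c assms(3) Cons by auto
  ultimately have "length as mod r = length (c # bs') mod r"
    using assms(1,2) c(2) unfolding CHFD_def atomic_factorization_def by metis
  then show ?thesis using Cons by (simp add: balanced_def)
qed


section \<open>Unbalanced equalities contain bad atoms\<close>

text \<open>Irredundancy sees subproducts only up to association, and trading \<open>b\<close> for
  \<open>c\<close> changes them at most by a unit.\<close>

lemma irredundant_adjust:
  assumes irr: "irredundant R as (b # bs)" and "c \<sim> b" "c \<in> atoms R"
    and as: "set as \<subseteq> atoms R" and bs: "set (b # bs) \<subseteq> atoms R"
  shows "irredundant R as (c # bs)"
  unfolding irredundant_def
proof (intro allI impI notI)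
  fix I J
  assume IJ: "I \<noteq> {} \<and> I \<subset> {..<length as} \<and> J \<noteq> {} \<and> J \<subset> {..<length (c # bs)}"
    and eq: "list_prod R (nths as I) \<sim> list_prod R (nths (c # bs) J)"
  have sub: "set (nths bs K) \<subseteq> atoms R" "set (nths as K) \<subseteq> atoms R" for K
    using as bs set_nths_subset by fastforce+
  \<comment> \<open>The two lists agree except at position 0, so the subproducts are equal or differ
    by the factor \<open>c\<close> against \<open>b\<close>.\<close>
  have "list_prod R (nths (c # bs) J) \<sim> list_prod R (nths (b # bs) J)"
    using assms sub list_prod_atoms_closed by (auto simp: nths_Cons atoms_iff intro!: mult_cong_l)
  moreover have "set (nths (c # bs) J) \<subseteq> atoms R" "set (nths (b # bs) J) \<subseteq> atoms R"
    using assms sub by (auto simp: nths_Cons)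
  ultimately have "list_prod R (nths as I) \<sim> list_prod R (nths (b # bs) J)"
    using eq sub list_prod_atoms_closed associated_trans by meson
  then show False using irr IJ unfolding irredundant_def by simp
qed

text \<open>The unit is absorbed into an atom on the right, so \<open>as\<close> survives intact in
  the resulting exact equality. The atoms of \<open>bs\<close> are reached by swapping the
  sides.\<close>

lemma irredundant_unbalanced_bad:
  assumes as: "set as \<subseteq> atoms R" and bs: "set bs \<subseteq> atoms R"
    and eq: "list_prod R as \<sim> list_prod R bs"
    and "irredundant R as bs" "\<not> balanced r as bs" "a \<in> set as"
  shows "bad_atom r R a"
proof (cases bs)
  case Nil
  then show ?thesis using associated_list_prod_Nil_iff[OF as bs eq] assms(6) by simp
next
  case (Cons b bs')
  then obtain c where c: "c \<in> atoms R" "c \<sim> b" "list_prod R as = list_prod R (c # bs')"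
    using associated_list_prod_adjust as bs eq by metis
  have "irredundant R as (c # bs')"
    using irredundant_adjust assms c Cons by metis
  moreover have "atomic_equality R as (c # bs')"
    using as bs Cons c assms(6) unfolding atomic_equality_def by auto
  ultimately show ?thesis
    unfolding bad_atom_def using assms(5,6) Cons
    by (intro exI[of _ as] exI[of _ "c # bs'"]) (simp add: balanced_def)
qed

lemma irredundant_sym: "irredundant R as bs \<Longrightarrow> irredundant R bs as"
  unfolding irredundant_def using associated_sym by meson

end

section \<open>Splitting lists along index sets\<close>

lemma mset_nths_Compl: "mset (nths xs I) + mset (nths xs (- I)) = mset xs"
proof (induction xs arbitrary: I)
  case (Cons x xs)
  have "{j. Suc j \<in> - I} = - {j. Suc j \<in> I}" by auto
  then show ?case using Cons[of "{j. Suc j \<in> I}"] by (auto simp: nths_Cons)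
qed simp

lemma length_nths_less:
  assumes "I \<subset> {..<length xs}"
  shows "length (nths xs I) < length xs"
proof -
  have "{i. i < length xs \<and> i \<in> I} \<subset> {..<length xs}" using assms by auto
  then have "card {i. i < length xs \<and> i \<in> I} < card {..<length xs}"
    by (intro psubset_card_mono) auto
  then show ?thesis by (simp add: length_nths)
qed

lemma length_nths_pos:
  assumes "I \<noteq> {}" "I \<subset> {..<length xs}"
  shows "length (nths xs I) > 0"
  using assms by (auto simp: length_nths card_gt_0_iff)

lemma subseteq_mset_single:
  assumes "mset xs \<subseteq># {#a#}"
  shows "xs = [] \<or> xs = [a]"
proof (cases xs)
  case (Cons x ys)
  have "length xs \<le> 1" using size_mset_mono[OF assms] by simp
  moreover have "set xs \<subseteq> {a}" using set_mset_mono[OF assms] by simp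
  ultimately show ?thesis using Cons by simp
qed simp

context domain
begin

lemma list_prod_mset_cong:
  assumes "mset as = mset bs" "set bs \<subseteq> atoms R"
  shows "list_prod R as = list_prod R bs"
proof -
  have "set as \<subseteq> carrier R" "set bs \<subseteq> carrier R"
    using assms mset_eq_setD atoms_carrier by blast+
  then show ?thesis using multlist_perm_cong[OF assms(1)] by blast
qed

text \<open>A redundant pair splits into two strictly shorter associated pairs, one of which is
  unbalanced because lengths add up.\<close>

lemma unbalanced_contains_bad:
  assumes "set as \<subseteq> atoms R" "set bs \<subseteq> atoms R"
    and "list_prod R as \<sim> list_prod R bs" "\<not> balanced r as bs"
  shows "\<exists>as' bs'. mset as' \<subseteq># mset as \<and> mset bs' \<subseteq># mset bs \<and>
    list_prod R as' \<sim> list_prod R bs' \<and> \<not> balanced r as' bs' \<and>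
    (\<forall>a\<in>set as' \<union> set bs'. bad_atom r R a)"
  using assms
proof (induction "length as" arbitrary: as bs rule: less_induct)
  case less
  note at = less.prems(1,2) and eq = less.prems(3) and unb = less.prems(4)
  show ?case
  proof (cases "irredundant R as bs")
    case True
    have "bad_atom r R a" if "a \<in> set as" for a
      using irredundant_unbalanced_bad[OF at eq True unb that] .
    moreover have "bad_atom r R b" if "b \<in> set bs" for b
      using irredundant_unbalanced_bad[OF at(2,1) associated_sym[OF eq] irredundant_sym[OF True] _ that]
        unb by (simp add: balanced_def)
    ultimately show ?thesis using eq unb by (intro exI[of _ as] exI[of _ bs]) auto
  next
    case False
    then obtain I J where I: "I \<noteq> {}" "I \<subset> {..<length as}" and J: "J \<noteq> {}" "J \<subset> {..<length bs}"
      and IJ: "list_prod R (nths as I) \<sim> list_prod R (nths bs J)"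
      unfolding irredundant_def by blast
    let ?a = "nths as I" and ?a' = "nths as (- I)" and ?b = "nths bs J" and ?b' = "nths bs (- J)"
    have ma: "mset ?a + mset ?a' = mset as" and mb: "mset ?b + mset ?b' = mset bs"
      by (rule mset_nths_Compl)+
    then have la: "length ?a + length ?a' = length as" and lb: "length ?b + length ?b' = length bs"
      by (metis size_mset size_union)+
    have sub: "set ?a \<subseteq> atoms R" "set ?a' \<subseteq> atoms R" "set ?b \<subseteq> atoms R" "set ?b' \<subseteq> atoms R"
      using at set_nths_subset by fast+
    have "list_prod R as = list_prod R ?a \<otimes> list_prod R ?a'"
      using list_prod_mset_cong[of "?a @ ?a'" as] ma at sub
        list_prod_atoms_append[of ?a ?a'] by (simp del: foldr_append)
    moreover have "list_prod R bs = list_prod R ?b \<otimes> list_prod R ?b'"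
      using list_prod_mset_cong[of "?b @ ?b'" bs] mb at sub
        list_prod_atoms_append[of ?b ?b'] by (simp del: foldr_append)
    \<comment> \<open>Cancelling the associated subproducts over \<open>I\<close> and
      \<open>J\<close> leaves the complementary ones associated.\<close>
    ultimately have IJ': "list_prod R ?a' \<sim> list_prod R ?b'"
      using eq associated_mult_cancel IJ sub list_prod_atoms_closed list_prod_atoms_nonzero by metis
    \<comment> \<open>\<open>I\<close> is nonempty and proper, so neither \<open>I\<close> nor its
      complement takes all of \<open>as\<close>, and the induction hypothesis applies to both
      parts.\<close>
    have len: "length ?a < length as" "length ?a' < length as"
      using length_nths_less[OF I(2)] length_nths_pos[OF I] la by linarith+
    have msub: "mset ?a \<subseteq># mset as" "mset ?a' \<subseteq># mset as" "mset ?b \<subseteq># mset bs" "mset ?b' \<subseteq># mset bs"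
      using ma mb by (metis mset_subset_eq_add_left mset_subset_eq_add_right)+
    have "\<not> balanced r ?a ?b \<or> \<not> balanced r ?a' ?b'"
      using mod_add_cong[of "length ?a" r "length ?b" "length ?a'" "length ?b'"] unb
      unfolding balanced_def la lb by blast
    then show ?thesis
    proof
      assume "\<not> balanced r ?a ?b"
      from less.hyps[OF len(1) sub(1,3) IJ this] show ?thesis
        using subset_mset.order_trans[OF _ msub(1)] subset_mset.order_trans[OF _ msub(3)] by blast
    next
      assume "\<not> balanced r ?a' ?b'"
      from less.hyps[OF len(2) sub(2,4) IJ' this] show ?thesis
        using subset_mset.order_trans[OF _ msub(2)] subset_mset.order_trans[OF _ msub(4)] by blast
    qed
  qed
qed

section \<open>Factors of products that are units or atoms\<close>

lemma atoms_associated: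
  assumes "a \<in> atoms R" "a \<sim> b" "b \<in> carrier R"
  shows "b \<in> atoms R"
  using assms Units_mult_atom ring_associated_iff associated_sym atoms_carrier by metis

lemma list_prod_Units:
  assumes "set as \<subseteq> carrier R" "list_prod R as \<in> Units R"
  shows "set as \<subseteq> Units R"
  using assms
proof (induction as)
  case (Cons a as)
  then show ?case
    using unit_factor_left[of a "list_prod R as"] unit_factor_left[of "list_prod R as" a]
      list_prod_closed[of as] m_comm[of a "list_prod R as"] by auto
qed simp

text \<open>Of two factors of an atom one is a unit, so units can be stripped off until a single
  factor carries the product up to association. The entries are arbitrary because images under
  \<open>h\<close> of atoms of \<open>A\<close> need not be atoms.\<close>

lemma list_prod_atom_obtain:
  assumes "set as \<subseteq> carrier R" "list_prod R as \<in> atoms R"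
  shows "\<exists>a\<in>set as. a \<in> atoms R \<and> list_prod R as \<sim> a"
  using assms
proof (induction as)
  case Nil
  then show ?case by (simp add: atoms_iff)
next
  case (Cons a as)
  let ?p = "list_prod R as"
  have ac: "a \<in> carrier R" and pc: "?p \<in> carrier R" and at: "a \<otimes> ?p \<in> atoms R"
    using Cons.prems list_prod_closed by auto
  consider "a \<in> Units R" | "?p \<in> Units R" using at ac pc unfolding atoms_iff by blast
  then show ?case
  proof cases
    case 1
    have "a \<otimes> ?p \<sim> ?p" using 1 ring_associated_iff ac pc by auto
    moreover from this have "?p \<in> atoms R" using atoms_associated at pc by blast
    ultimately show ?thesis
      using Cons.IH Cons.prems(1) associated_trans ac pc by (metis (no_types, lifting) foldr.simps(2)
        comp_apply list.set_intros(2) m_closed set_subset_Cons subset_iff)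
  next
    case 2
    have "a \<otimes> ?p \<sim> a" using 2 ring_associated_iff[of "a \<otimes> ?p" a] ac pc m_comm by auto
    moreover from this have "a \<in> atoms R" using atoms_associated at ac by blast
    ultimately show ?thesis by auto
  qed
qed

end


section \<open>Lifting congruences from the localization\<close>

text \<open>Hides the pairs and classes of the localization behind the multiplicative properties of
  the map from \<open>a\<close> to \<open>a/1\<close>. Saturation of \<open>S\<close> is encoded in
  \<open>h_Units_iff\<close>, the condition on nonunits of \<open>S\<close> in
  \<open>S_good\<close>.\<close>

locale good_localization = A: domain A + L: domain L
  for A :: "('a, 'b) ring_scheme" and L :: "('c, 'd) ring_scheme" +
  fixes S :: "'a set" and h :: "'a \<Rightarrow> 'c" and r :: nat
  assumes atomic: "atomic_domain A"
    and S_carrier: "S \<subseteq> carrier A"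
    and h_closed: "a \<in> carrier A \<Longrightarrow> h a \<in> carrier L"
    and h_mult: "a \<in> carrier A \<Longrightarrow> b \<in> carrier A \<Longrightarrow> h (a \<otimes>\<^bsub>A\<^esub> b) = h a \<otimes>\<^bsub>L\<^esub> h b"
    and h_one: "h \<one>\<^bsub>A\<^esub> = \<one>\<^bsub>L\<^esub>"
    and h_zero: "h \<zero>\<^bsub>A\<^esub> = \<zero>\<^bsub>L\<^esub>"
    and h_inj: "inj_on h (carrier A)"
    and h_Units_iff: "a \<in> carrier A \<Longrightarrow> h a \<in> Units L \<longleftrightarrow> a \<in> S"
    and fraction: "x \<in> carrier L \<Longrightarrow> \<exists>a\<in>carrier A. \<exists>s\<in>S. x \<otimes>\<^bsub>L\<^esub> h s = h a"
    and S_good: "a \<in> atoms A \<Longrightarrow> a \<in> S \<Longrightarrow> \<not> bad_atom r A a"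
    and CHFD_L: "CHFD r L"
begin

text \<open>The atoms of \<open>A\<close> whose contribution to lengths is under control: those in
  \<open>S\<close> are never bad, those outside \<open>S\<close> still count as one atom in
  \<open>L\<close>. All other atoms of \<open>A\<close> split in \<open>L\<close>.\<close>

definition stable_atoms :: "'a set"
  where "stable_atoms = {a \<in> atoms A. a \<in> S \<or> h a \<in> atoms L}"

lemma stable_atoms_subset: "stable_atoms \<subseteq> atoms A"
  by (auto simp: stable_atoms_def)

lemma h_list_prod: "set as \<subseteq> carrier A \<Longrightarrow> h (list_prod A as) = list_prod L (map h as)"
  by (induction as) (auto simp: h_one h_mult A.list_prod_closed)

lemma h_associated:
  assumes "a \<sim>\<^bsub>A\<^esub> b" "a \<in> carrier A" "b \<in> carrier A"
  shows "h a \<sim>\<^bsub>L\<^esub> h b"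
proof -
  obtain u where u: "u \<in> Units A" "a = u \<otimes>\<^bsub>A\<^esub> b"
    using assms A.ring_associated_iff by blast
  have uc: "u \<in> carrier A" "inv\<^bsub>A\<^esub> u \<in> carrier A" using u by auto
  have "h u \<otimes>\<^bsub>L\<^esub> h (inv\<^bsub>A\<^esub> u) = \<one>\<^bsub>L\<^esub>"
    using u uc by (simp flip: h_mult add: h_one)
  then have "h u \<in> Units L"
    using L.unit_factor_left[of "h u" "h (inv\<^bsub>A\<^esub> u)"] uc h_closed by simp
  then show ?thesis
    using L.ring_associated_iff[of "h a" "h b"] h_closed h_mult u(2) uc assms by blast
qed

text \<open>A unit \<open>u\<close> of \<open>L\<close> is a fraction \<open>t/s\<close>. As
  \<open>h t\<close> is the product of the units \<open>u\<close> and \<open>h s\<close>, also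
  \<open>t\<close> lies in \<open>S\<close>, and injectivity of \<open>h\<close> brings the cleared
  equation back to \<open>A\<close>.\<close>

lemma h_associatedD:
  assumes "h a \<sim>\<^bsub>L\<^esub> h b" "a \<in> carrier A" "b \<in> carrier A"
  obtains s t where "s \<in> S" "t \<in> S" "a \<otimes>\<^bsub>A\<^esub> s = b \<otimes>\<^bsub>A\<^esub> t"
proof -
  obtain u where u: "u \<in> Units L" "h a = u \<otimes>\<^bsub>L\<^esub> h b"
    using assms L.ring_associated_iff h_closed by meson
  obtain t s where t: "t \<in> carrier A" "s \<in> S" "u \<otimes>\<^bsub>L\<^esub> h s = h t"
    using fraction u by blast
  have s: "s \<in> carrier A" using t S_carrier by auto
  have "h t \<in> Units L" using u t s h_Units_iff by (metis L.Units_m_closed)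
  then have "t \<in> S" using h_Units_iff t by blast
  have hc: "h a \<in> carrier L" "h b \<in> carrier L" "h s \<in> carrier L" "u \<in> carrier L"
    using h_closed assms s u by auto
  have "h (a \<otimes>\<^bsub>A\<^esub> s) = h b \<otimes>\<^bsub>L\<^esub> (u \<otimes>\<^bsub>L\<^esub> h s)"
    using h_mult assms s u(2) hc by (simp add: L.m_ac)
  then have "h (a \<otimes>\<^bsub>A\<^esub> s) = h (b \<otimes>\<^bsub>A\<^esub> t)"
    using h_mult assms t by simp
  then have "a \<otimes>\<^bsub>A\<^esub> s = b \<otimes>\<^bsub>A\<^esub> t"
    using h_inj assms s t by (auto dest: inj_onD)
  then show ?thesis using that \<open>t \<in> S\<close> t by blast
qed

section \<open>Lifting factorizations from \<open>L\<close> to \<open>A\<close>\<close>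

lemma atomic_factors:
  assumes "x \<in> carrier A" "x \<noteq> \<zero>\<^bsub>A\<^esub>"
  obtains as where "set as \<subseteq> atoms A" "list_prod A as \<sim>\<^bsub>A\<^esub> x"
proof (cases "x \<in> Units A")
  case True
  then have "\<one>\<^bsub>A\<^esub> \<sim>\<^bsub>A\<^esub> x"
    using A.ring_associated_iff[of x "\<one>\<^bsub>A\<^esub>"] assms A.associated_sym by force
  then show ?thesis using that[of "[]"] by simp
next
  case False
  then obtain as where "atomic_factorization A as x"
    using atomic assms unfolding atomic_domain_def by blast
  then show ?thesis
    using that[of as] A.associated_refl[OF assms(1)] by (simp add: atomic_factorization_def)
qed

text \<open>The image of the product is a unit of \<open>L\<close>, hence so is the image of each
  factor, which puts the factor back into \<open>S\<close>.\<close>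

lemma S_factors:
  assumes "s \<in> S"
  obtains ls where "set ls \<subseteq> atoms A \<inter> S" "list_prod A ls \<sim>\<^bsub>A\<^esub> s"
proof -
  have s: "s \<in> carrier A" using assms S_carrier by auto
  have hs: "h s \<in> Units L" using h_Units_iff assms s by blast
  then have "s \<noteq> \<zero>\<^bsub>A\<^esub>" using h_zero L.zero_not_Units by auto
  then obtain ls where ls: "set ls \<subseteq> atoms A" "list_prod A ls \<sim>\<^bsub>A\<^esub> s"
    using atomic_factors s by blast
  have lc: "set ls \<subseteq> carrier A" using ls A.atoms_carrier by blast
  have hl: "set (map h ls) \<subseteq> carrier L" using lc h_closed by auto
  have "h s \<sim>\<^bsub>L\<^esub> h (list_prod A ls)"
    using h_associated[OF ls(2)] s A.list_prod_closed[OF lc] L.associated_sym by blast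
  then have "list_prod L (map h ls) \<in> Units L"
    using L.associated_Units[of "h s"] hs L.list_prod_closed[OF hl] h_list_prod[OF lc] by simp
  then have "set (map h ls) \<subseteq> Units L" using L.list_prod_Units hl by blast
  then have "set ls \<subseteq> S" using h_Units_iff lc by auto
  then show ?thesis using that ls by blast
qed

text \<open>\<open>p\<close> may have several atoms in \<open>A\<close>, but its image is an atom of
  \<open>L\<close>, so the image of one of them already equals \<open>h p\<close> up to a
  unit.\<close>

lemma atom_lift:
  assumes "p \<in> carrier A" "h p \<in> atoms L"
  obtains q where "q \<in> atoms A" "h q \<in> atoms L" "h p \<sim>\<^bsub>L\<^esub> h q"
proof -
  have "p \<noteq> \<zero>\<^bsub>A\<^esub>" using assms h_zero by (auto simp: L.atoms_iff)
  then obtain qs where qs: "set qs \<subseteq> atoms A" "list_prod A qs \<sim>\<^bsub>A\<^esub> p"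
    using atomic_factors assms by blast
  have qc: "set qs \<subseteq> carrier A" using qs A.atoms_carrier by blast
  have hq: "set (map h qs) \<subseteq> carrier L" using qc h_closed by auto
  have pq: "h p \<sim>\<^bsub>L\<^esub> list_prod L (map h qs)"
    using h_associated[OF qs(2)] assms A.list_prod_closed[OF qc] L.associated_sym h_list_prod[OF qc]
    by simp
  then have "list_prod L (map h qs) \<in> atoms L"
    using L.atoms_associated assms(2) L.list_prod_closed[OF hq] by blast
  then obtain x where x: "x \<in> set (map h qs)" "x \<in> atoms L" "list_prod L (map h qs) \<sim>\<^bsub>L\<^esub> x"
    using L.list_prod_atom_obtain hq by blast
  then obtain q where "q \<in> set qs" "x = h q" by auto
  moreover have "h p \<sim>\<^bsub>L\<^esub> x"
    using L.associated_trans[OF pq x(3)] h_closed assms(1) x(2) L.atoms_carrier by blast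
  ultimately show ?thesis using that x qs by blast
qed

text \<open>The lift is chosen atom by atom: denominators are units of \<open>L\<close>, so each
  atom of \<open>L\<close> is associated to the image of an element of \<open>A\<close>, and then to
  that of an atom of \<open>A\<close>.\<close>

lemma list_atoms_lift:
  assumes "set xs \<subseteq> atoms L"
  shows "\<exists>qs. set qs \<subseteq> stable_atoms \<and> list_prod L xs \<sim>\<^bsub>L\<^esub> h (list_prod A qs)"
  using assms
proof (induction xs)
  case Nil
  have "\<one>\<^bsub>L\<^esub> \<sim>\<^bsub>L\<^esub> \<one>\<^bsub>L\<^esub>"
    by (rule L.associated_refl[OF L.one_closed])
  then show ?case by (intro exI[of _ "[]"]) (simp only: foldr.simps id_apply h_one list.set empty_subsetI simp_thms)
next
  case (Cons x xs)
  from Cons.prems have "set xs \<subseteq> atoms L" by simp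
  with Cons.IH obtain qs
    where qs: "set qs \<subseteq> stable_atoms" "list_prod L xs \<sim>\<^bsub>L\<^esub> h (list_prod A qs)"
    by blast
  have x: "x \<in> atoms L" "x \<in> carrier L" using Cons.prems L.atoms_carrier by auto
  obtain p s where p: "p \<in> carrier A" "s \<in> S" "x \<otimes>\<^bsub>L\<^esub> h s = h p"
    using fraction x by blast
  have s: "h s \<in> Units L" using p S_carrier h_Units_iff by blast
  have "h p = h s \<otimes>\<^bsub>L\<^esub> x"
    using p(3) L.m_comm[OF x(2) L.Units_closed[OF s]] by simp
  then have xp: "h p \<sim>\<^bsub>L\<^esub> x"
    using L.ring_associated_iff[OF h_closed[OF p(1)] x(2)] s by blast
  then have "h p \<in> atoms L"
    using L.atoms_associated x h_closed p L.associated_sym by blast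
  then obtain q where q: "q \<in> atoms A" "h q \<in> atoms L" "h p \<sim>\<^bsub>L\<^esub> h q"
    using atom_lift p by blast
  have qc: "q \<in> carrier A" "list_prod A qs \<in> carrier A"
    using q A.atoms_carrier A.list_prod_atoms_closed stable_atoms_subset qs by blast+
  have "x \<sim>\<^bsub>L\<^esub> h q"
    using L.associated_trans L.associated_sym xp q(3) h_closed p qc x by meson
  moreover have "list_prod L xs \<in> carrier L" using Cons.prems L.list_prod_atoms_closed by simp
  ultimately have "x \<otimes>\<^bsub>L\<^esub> list_prod L xs \<sim>\<^bsub>L\<^esub> h q \<otimes>\<^bsub>L\<^esub> h (list_prod A qs)"
    using L.associated_mult qs(2) x qc h_closed by blast
  then show ?case
    using q qs qc h_mult by (intro exI[of _ "q # qs"]) (auto simp: stable_atoms_def)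
qed

section \<open>Balancedness for stable atoms, then for all atoms\<close>

lemma stable_balanced:
  assumes as: "set as \<subseteq> stable_atoms" and bs: "set bs \<subseteq> stable_atoms"
    and eq: "list_prod A as \<sim>\<^bsub>A\<^esub> list_prod A bs"
  shows "balanced r as bs"
proof (rule ccontr)
  assume "\<not> balanced r as bs"
  then obtain as' bs' where ab: "mset as' \<subseteq># mset as" "mset bs' \<subseteq># mset bs"
      "list_prod A as' \<sim>\<^bsub>A\<^esub> list_prod A bs'" "\<not> balanced r as' bs'"
      "\<forall>a\<in>set as' \<union> set bs'. bad_atom r A a"
    using A.unbalanced_contains_bad[of as bs r] as bs eq stable_atoms_subset by blast
  have st: "set as' \<subseteq> stable_atoms" "set bs' \<subseteq> stable_atoms"
    using set_mset_mono[OF ab(1)] set_mset_mono[OF ab(2)] as bs by auto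
  \<comment> \<open>No bad atom lies in \<open>S\<close>, so stability leaves only the alternative
    that the image is an atom of \<open>L\<close>.\<close>
  have hs: "set (map h as') \<subseteq> atoms L" "set (map h bs') \<subseteq> atoms L"
    using st ab(5) S_good unfolding stable_atoms_def by auto
  have c: "set as' \<subseteq> carrier A" "set bs' \<subseteq> carrier A"
    using st stable_atoms_subset A.atoms_carrier by blast+
  have "list_prod L (map h as') \<sim>\<^bsub>L\<^esub> list_prod L (map h bs')"
    using h_associated[OF ab(3)] A.list_prod_closed c h_list_prod by auto
  then have "balanced r (map h as') (map h bs')"
    using L.CHFD_associated CHFD_L hs by blast
  then show False using ab(4) by (simp add: balanced_def)
qed

text \<open>For \<open>a\<close> outside \<open>S\<close>, denominators are cleared in a
  factorization of \<open>h a\<close>: \<open>ls\<close> and part of \<open>ns\<close> come from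
  \<open>S\<close>, the remaining entries of \<open>ns\<close> represent the atoms of
  \<open>L\<close>.\<close>

lemma stable_cofactor_atom:
  assumes a: "a \<in> atoms A"
  obtains ls ns where "set ls \<subseteq> stable_atoms" "set ns \<subseteq> stable_atoms"
    "list_prod A (a # ls) \<sim>\<^bsub>A\<^esub> list_prod A ns" "balanced r (a # ls) ns"
proof (cases "a \<in> S")
  case True
  have "a \<in> carrier A" using a A.atoms_carrier by blast
  \<comment> \<open>An atom in \<open>S\<close> is already stable and takes the empty
    cofactor.\<close>
  then show ?thesis
    using that[of "[]" "[a]"] True a by (auto simp: stable_atoms_def balanced_def)
next
  case False
  have ac: "a \<in> carrier A" using a A.atoms_carrier by blast
  have "a \<noteq> \<zero>\<^bsub>A\<^esub>" using a by (simp add: A.atoms_iff)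
  \<comment> \<open>Injectivity of \<open>h\<close> keeps \<open>h a\<close> nonzero and
    \<open>a\<close> outside \<open>S\<close> keeps it a nonunit, so it has a factorization in
    \<open>L\<close>.\<close>
  then have "h a \<noteq> \<zero>\<^bsub>L\<^esub>"
    using inj_onD[OF h_inj _ ac A.zero_closed] h_zero by auto
  then have "h a \<in> carrier L - Units L - {\<zero>\<^bsub>L\<^esub>}"
    using False ac h_Units_iff h_closed by blast
  then obtain xs where xs: "set xs \<subseteq> atoms L" "list_prod L xs = h a"
    using CHFD_L unfolding CHFD_def atomic_domain_def atomic_factorization_def by blast
  obtain qs where qs: "set qs \<subseteq> stable_atoms" "h a \<sim>\<^bsub>L\<^esub> h (list_prod A qs)"
    using list_atoms_lift[OF xs(1)] xs(2) by auto
  have qc: "set qs \<subseteq> atoms A" "list_prod A qs \<in> carrier A"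
    using qs stable_atoms_subset A.list_prod_atoms_closed by blast+
  obtain s t where st: "s \<in> S" "t \<in> S" "a \<otimes>\<^bsub>A\<^esub> s = list_prod A qs \<otimes>\<^bsub>A\<^esub> t"
    using h_associatedD qs(2) ac qc by blast
  have stc: "s \<in> carrier A" "t \<in> carrier A" using st S_carrier by auto
  obtain ls where ls: "set ls \<subseteq> atoms A \<inter> S" "list_prod A ls \<sim>\<^bsub>A\<^esub> s"
    using S_factors st by blast
  obtain ms where ms: "set ms \<subseteq> atoms A \<inter> S" "list_prod A ms \<sim>\<^bsub>A\<^esub> t"
    using S_factors st by blast
  have at: "set ls \<subseteq> atoms A" "set ms \<subseteq> atoms A" using ls ms by auto
  have lc: "list_prod A ls \<in> carrier A" "list_prod A ms \<in> carrier A"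
    using at A.list_prod_atoms_closed by auto
  \<comment> \<open>\<open>qs\<close> realizes the atoms of \<open>L\<close>; \<open>ms\<close>
    factors the numerator \<open>t\<close> left over from the unit.\<close>
  let ?ns = "qs @ ms"
  have "a \<otimes>\<^bsub>A\<^esub> list_prod A ls \<sim>\<^bsub>A\<^esub> a \<otimes>\<^bsub>A\<^esub> s"
    using A.associated_mult ls lc ac stc by simp
  moreover have "list_prod A qs \<otimes>\<^bsub>A\<^esub> t \<sim>\<^bsub>A\<^esub> list_prod A ?ns"
    using A.associated_mult[of "list_prod A qs" "list_prod A qs" t "list_prod A ms"] ms(2) lc qc stc
      A.associated_sym A.list_prod_atoms_append[OF qc(1) at(2)] by (simp del: foldr_append)
  moreover have nc: "list_prod A ?ns \<in> carrier A"
    by (rule A.list_prod_atoms_closed) (use qc at in auto)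
  ultimately have eq: "list_prod A (a # ls) \<sim>\<^bsub>A\<^esub> list_prod A ?ns"
    using st(3) A.associated_trans[of "a \<otimes>\<^bsub>A\<^esub> list_prod A ls" "a \<otimes>\<^bsub>A\<^esub> s" "list_prod A ?ns"] ac lc
    by (simp del: foldr_append)
  have als: "set (a # ls) \<subseteq> atoms A" and ans: "set ?ns \<subseteq> atoms A"
    using a at qc by auto
  have "balanced r (a # ls) ?ns"
  proof (rule ccontr)
    assume "\<not> balanced r (a # ls) ?ns"
    then obtain as bs where ab: "mset as \<subseteq># mset (a # ls)" "mset bs \<subseteq># mset ?ns"
        "list_prod A as \<sim>\<^bsub>A\<^esub> list_prod A bs" "\<not> balanced r as bs"
        "\<forall>c\<in>set as \<union> set bs. bad_atom r A c"
      using A.unbalanced_contains_bad[OF als ans eq] by blast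
    have bs: "set bs \<subseteq> atoms A"
      using set_mset_mono[OF ab(2)] ans by (simp only: set_mset_mset)
    have as: "set as \<subseteq> atoms A"
      using set_mset_mono[OF ab(1)] als by (simp only: set_mset_mset)
    \<comment> \<open>Entries of \<open>ls\<close> lie in \<open>S\<close> and are not bad, so a bad
      part of \<open>a # ls\<close> can use only the head \<open>a\<close>, and only once.\<close>
    have "mset as \<subseteq># {#a#}"
    proof (rule mset_subset_eqI)
      fix c
      show "count (mset as) c \<le> count {#a#} c"
      proof (cases "c \<in> set as")
        case True
        then have "c \<notin> set ls" using ab(5) ls S_good by auto
        then have "count (mset ls) c = 0" by (simp add: count_eq_zero_iff)
        with mset_subset_eq_count[OF ab(1), of c] show ?thesis
          by (simp split: if_splits del: count_mset_0_iff count_greater_eq_Suc_zero_iff)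
      next
        case False
        then have "count (mset as) c = 0" by (simp add: count_eq_zero_iff)
        then show ?thesis by (simp only: le0)
      qed
    qed
    then have "as = [] \<or> as = [a]"
      by (rule subseteq_mset_single)
    \<comment> \<open>With \<open>as\<close> empty, \<open>bs\<close> would be empty too and the
      pair balanced.\<close>
    moreover have "as \<noteq> []"
      using A.associated_list_prod_Nil_iff[OF as bs ab(3)] ab(4) by (auto simp: balanced_def)
    ultimately have "as = [a]" by simp
    \<comment> \<open>An atom is associated only to one-element products of atoms, so the part has
      length 1 on both sides and is balanced after all.\<close>
    then have "a \<sim>\<^bsub>A\<^esub> list_prod A bs"
      using ab(3) ac by simp
    then obtain b where "bs = [b]"
      by (rule A.list_prod_associated_atom[OF bs a])
    then show False using ab(4) \<open>as = [a]\<close> by (simp add: balanced_def)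
  qed
  moreover have "set ls \<subseteq> stable_atoms" "set ?ns \<subseteq> stable_atoms"
    using ls ms qs(1) by (auto simp: stable_atoms_def)
  ultimately show ?thesis using that eq by blast
qed

text \<open>The cofactors of the single atoms are concatenated, and the congruences between lengths
  add.\<close>

lemma stable_cofactor:
  assumes "set as \<subseteq> atoms A"
  shows "\<exists>ls ns. set ls \<subseteq> stable_atoms \<and> set ns \<subseteq> stable_atoms \<and>
    list_prod A (as @ ls) \<sim>\<^bsub>A\<^esub> list_prod A ns \<and> balanced r (as @ ls) ns"
  using assms
proof (induction as)
  case Nil
  then show ?case by (intro exI[of _ "[]"]) (auto simp: balanced_def)
next
  case (Cons a as)
  then obtain ls ns where l: "set ls \<subseteq> stable_atoms" "set ns \<subseteq> stable_atoms"
    "list_prod A (as @ ls) \<sim>\<^bsub>A\<^esub> list_prod A ns" "balanced r (as @ ls) ns"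
    by (metis set_subset_Cons subset_trans)
  obtain ls' ns' where l': "set ls' \<subseteq> stable_atoms" "set ns' \<subseteq> stable_atoms"
    "list_prod A (a # ls') \<sim>\<^bsub>A\<^esub> list_prod A ns'" "balanced r (a # ls') ns'"
    using stable_cofactor_atom[of a] Cons.prems by auto
  have at: "set (as @ ls) \<subseteq> atoms A" "set ns \<subseteq> atoms A" "set (a # ls') \<subseteq> atoms A" "set ns' \<subseteq> atoms A"
    "set ((a # as) @ ls' @ ls) \<subseteq> atoms A"
    using Cons.prems l l' stable_atoms_subset by auto
  have "list_prod A ((a # as) @ ls' @ ls) = list_prod A ((a # ls') @ (as @ ls))"
    by (rule A.list_prod_mset_cong) (use at in auto)
  also have "\<dots> = list_prod A (a # ls') \<otimes>\<^bsub>A\<^esub> list_prod A (as @ ls)"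
    using A.list_prod_atoms_append at by blast
  also have "\<dots> \<sim>\<^bsub>A\<^esub> list_prod A ns' \<otimes>\<^bsub>A\<^esub> list_prod A ns"
    using A.associated_mult l(3) l'(3) A.list_prod_atoms_closed at by blast
  also have "list_prod A ns' \<otimes>\<^bsub>A\<^esub> list_prod A ns = list_prod A (ns' @ ns)"
    using A.list_prod_atoms_append at by simp
  finally have "list_prod A ((a # as) @ ls' @ ls) \<sim>\<^bsub>A\<^esub> list_prod A (ns' @ ns)" .
  moreover have "balanced r ((a # as) @ ls' @ ls) (ns' @ ns)"
    using mod_add_cong[OF l(4)[unfolded balanced_def] l'(4)[unfolded balanced_def]]
    by (simp add: balanced_def ac_simps)
  ultimately show ?case
    using l l' by (intro exI[of _ "ls' @ ls"] exI[of _ "ns' @ ns"]) auto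
qed

text \<open>Two factorizations \<open>as\<close>, \<open>bs\<close> of one element receive cofactors
  \<open>ls\<close>, \<open>ls'\<close>. Multiplying each by the cofactor of the other gives the
  same element, hence associated stable products \<open>ns @ ls'\<close> and
  \<open>ns' @ ls\<close>.\<close>

lemma CHFD_A: "CHFD r A"
  unfolding CHFD_def
proof (intro conjI atomic ballI allI impI)
  fix x as bs
  assume "atomic_factorization A as x \<and> atomic_factorization A bs x"
  then have as: "set as \<subseteq> atoms A" and bs: "set bs \<subseteq> atoms A"
    and eq: "list_prod A as = list_prod A bs"
    by (auto simp: atomic_factorization_def)
  obtain ls ns where l: "set ls \<subseteq> stable_atoms" "set ns \<subseteq> stable_atoms"
    "list_prod A (as @ ls) \<sim>\<^bsub>A\<^esub> list_prod A ns" "balanced r (as @ ls) ns"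
    using stable_cofactor as by blast
  obtain ls' ns' where l': "set ls' \<subseteq> stable_atoms" "set ns' \<subseteq> stable_atoms"
    "list_prod A (bs @ ls') \<sim>\<^bsub>A\<^esub> list_prod A ns'" "balanced r (bs @ ls') ns'"
    using stable_cofactor bs by blast
  have at: "set ls \<subseteq> atoms A" "set ns \<subseteq> atoms A" "set ls' \<subseteq> atoms A" "set ns' \<subseteq> atoms A"
    using l l' stable_atoms_subset by auto
  note app = A.list_prod_atoms_append and cl = A.list_prod_atoms_closed
  have 1: "list_prod A as \<otimes>\<^bsub>A\<^esub> list_prod A ls \<otimes>\<^bsub>A\<^esub> list_prod A ls' \<sim>\<^bsub>A\<^esub> list_prod A (ns @ ls')"
    using A.associated_mult[of "list_prod A (as @ ls)" "list_prod A ns" "list_prod A ls'" "list_prod A ls'"]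
      l(3) app[OF as at(1)] app[OF at(2,3)] cl as at by (simp del: foldr_append)
  have 2: "list_prod A bs \<otimes>\<^bsub>A\<^esub> list_prod A ls' \<otimes>\<^bsub>A\<^esub> list_prod A ls \<sim>\<^bsub>A\<^esub> list_prod A (ns' @ ls)"
    using A.associated_mult[of "list_prod A (bs @ ls')" "list_prod A ns'" "list_prod A ls" "list_prod A ls"]
      l'(3) app[OF bs at(3)] app[OF at(4,1)] cl bs at by (simp del: foldr_append)
  have 3: "list_prod A as \<otimes>\<^bsub>A\<^esub> list_prod A ls \<otimes>\<^bsub>A\<^esub> list_prod A ls' =
      list_prod A bs \<otimes>\<^bsub>A\<^esub> list_prod A ls' \<otimes>\<^bsub>A\<^esub> list_prod A ls"
    unfolding eq using cl bs at by (simp add: A.m_ac)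
  have "list_prod A (ns @ ls') \<in> carrier A" "list_prod A (ns' @ ls) \<in> carrier A"
    by (rule cl; use at in auto)+
  then have "list_prod A (ns @ ls') \<sim>\<^bsub>A\<^esub> list_prod A (ns' @ ls)"
    using 1 2[folded 3] cl[OF as] cl[OF at(1)] cl[OF at(3)]
    by (meson A.associated_sym A.associated_trans A.m_closed)
  then have "balanced r (ns @ ls') (ns' @ ls)"
    by (intro stable_balanced) (use l l' in auto)
  \<comment> \<open>Both sides carry the same extra length, which then cancels modulo
    \<open>r\<close>.\<close>
  then have "(length as + (length ls + length ls')) mod r = (length bs + (length ls + length ls')) mod r"
    using mod_add_cong[OF l(4)[unfolded balanced_def] refl, of "length ls'"]
      mod_add_cong[OF l'(4)[unfolded balanced_def] refl, of "length ls"]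
    unfolding balanced_def length_append by (simp only: ac_simps)
  then show "length as mod r = length bs mod r"
    by (simp add: nat_mod_eq_iff)
qed

end

section \<open>The localization as an instance of the abstract setting\<close>

theorem theorem15:
  fixes A :: "('a, 'b) ring_scheme" and r :: nat and S :: "'a set"
  assumes "atomic_domain A"
    and "r > 1"
    and "submonoid S A"
    and "saturated A S"
    and "\<And>s. s \<in> S \<Longrightarrow> s \<notin> Units A \<Longrightarrow> \<exists>gs. (\<forall>g\<in>set gs. good_atom r A g) \<and> list_prod A gs = s"
    and "CHFD r (localization A S)"
  shows "CHFD r A"
proof -
  let ?L = "localization A S"
  let ?h = "\<lambda>a. fraction A S a \<one>\<^bsub>A\<^esub>"
  interpret A: domain A using assms(1) by (simp add: atomic_domain_def)
  interpret L: domain ?L using assms(6) by (simp add: CHFD_def atomic_domain_def)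
  interpret S: submonoid S A by (rule assms(3))
  note R = A.is_cring assms(3)
  note carr = localization_carrier[OF R] and mult = localization_mult[OF R]
    and one = localization_one[OF R] and zero = localization_zero[OF R]
    and eq_iff = fraction_eq_iff[OF R]
  have SC: "s \<in> S \<Longrightarrow> s \<in> carrier A" for s using S.subset by blast
  \<comment> \<open>A product of good atoms that equals an atom has just one factor, so that atom is
    itself good.\<close>
  have atom_good: "good_atom r A a" if a: "a \<in> atoms A" "a \<in> S" for a
  proof -
    obtain gs where gs: "\<forall>g\<in>set gs. good_atom r A g" "list_prod A gs = a"
      using assms(5)[OF a(2)] a(1) unfolding A.atoms_iff by blast
    have at: "set gs \<subseteq> atoms A" using gs(1) by (auto simp: good_atom_def)
    obtain g where "gs = [g]"
      using A.list_prod_associated_atom[OF at a(1)] gs(2) by (metis A.associated_refl A.atoms_carrier a(1))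
    then show ?thesis using gs at A.atoms_carrier by auto
  qed
  \<comment> \<open>Zero is a nonunit, so in \<open>S\<close> it would be a product of atoms, and
    such products are nonzero in a domain.\<close>
  have S_nonzero: "\<zero>\<^bsub>A\<^esub> \<notin> S"
  proof
    assume "\<zero>\<^bsub>A\<^esub> \<in> S"
    then obtain gs where "\<forall>g\<in>set gs. good_atom r A g" "list_prod A gs = \<zero>\<^bsub>A\<^esub>"
      using assms(5) A.zero_not_Units by blast
    then show False using A.list_prod_atoms_nonzero[of gs] by (auto simp: good_atom_def)
  qed
  \<comment> \<open>The auxiliary factor \<open>u\<close> of the fraction relation is nonzero and
    cancels, which leaves plain cross-multiplication.\<close>
  have h_eq: "fraction A S a s = fraction A S b t \<longleftrightarrow> a \<otimes>\<^bsub>A\<^esub> t = b \<otimes>\<^bsub>A\<^esub> s"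
    if "a \<in> carrier A" "s \<in> S" "b \<in> carrier A" "t \<in> S" for a s b t
  proof -
    have "u \<otimes>\<^bsub>A\<^esub> (a \<otimes>\<^bsub>A\<^esub> t) = u \<otimes>\<^bsub>A\<^esub> (b \<otimes>\<^bsub>A\<^esub> s) \<longleftrightarrow> a \<otimes>\<^bsub>A\<^esub> t = b \<otimes>\<^bsub>A\<^esub> s" if "u \<in> S" for u
      using A.m_lcancel[of u "a \<otimes>\<^bsub>A\<^esub> t" "b \<otimes>\<^bsub>A\<^esub> s"] that \<open>a \<in> carrier A\<close> \<open>b \<in> carrier A\<close>
        SC[OF \<open>s \<in> S\<close>] SC[OF \<open>t \<in> S\<close>] SC[OF that] S_nonzero A.m_closed by blast
    then show ?thesis using eq_iff[OF that] S.one_closed by blast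
  qed
  have h_Units: "?h a \<in> Units ?L \<longleftrightarrow> a \<in> S" if a: "a \<in> carrier A" for a
  proof
    assume "?h a \<in> Units ?L"
    then obtain y where "y \<in> carrier ?L" "?h a \<otimes>\<^bsub>?L\<^esub> y = \<one>\<^bsub>?L\<^esub>"
      using L.Units_r_inv[of "?h a"] L.Units_inv_closed[of "?h a"] by blast
    then obtain b t where bt: "b \<in> carrier A" "t \<in> S"
        "?h a \<otimes>\<^bsub>?L\<^esub> fraction A S b t = \<one>\<^bsub>?L\<^esub>"
      unfolding carr by blast
    \<comment> \<open>The inverse of \<open>a/1\<close> is written as \<open>b/t\<close>; then
      \<open>a\<close> divides an element of \<open>S\<close> and saturation applies.\<close>
    then have "a \<otimes>\<^bsub>A\<^esub> b = t"
      using h_eq[of "a \<otimes>\<^bsub>A\<^esub> b" t "\<one>\<^bsub>A\<^esub>" "\<one>\<^bsub>A\<^esub>"] a mult SC by (simp add: one)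
    then have "a divides\<^bsub>A\<^esub> t" using bt by auto
    then show "a \<in> S" using assms(4) a bt(2) unfolding saturated_def by blast
  next
    assume s: "a \<in> S"
    \<comment> \<open>The inverse of \<open>a/1\<close> is \<open>1/a\<close>, whose denominator is
      admissible.\<close>
    then have "?h a \<otimes>\<^bsub>?L\<^esub> fraction A S \<one>\<^bsub>A\<^esub> a = \<one>\<^bsub>?L\<^esub>"
      using a h_eq[of a a "\<one>\<^bsub>A\<^esub>" "\<one>\<^bsub>A\<^esub>"] mult by (simp add: one)
    moreover have "?h a \<in> carrier ?L" "fraction A S \<one>\<^bsub>A\<^esub> a \<in> carrier ?L"
      unfolding carr using a s S.one_closed A.one_closed by blast+
    ultimately show "?h a \<in> Units ?L" using L.unit_factor_left by (metis L.Units_one_closed)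
  qed
  interpret good_localization A ?L S ?h r
  proof
    fix x assume "x \<in> carrier ?L"
    then obtain a s where as: "a \<in> carrier A" "s \<in> S" "x = fraction A S a s"
      unfolding carr by auto
    \<comment> \<open>Multiplying \<open>a/s\<close> by \<open>s/1\<close> clears the
      denominator.\<close>
    then have "x \<otimes>\<^bsub>?L\<^esub> ?h s = ?h a"
      using h_eq[of "a \<otimes>\<^bsub>A\<^esub> s" s a "\<one>\<^bsub>A\<^esub>"] mult SC by simp
    then show "\<exists>a\<in>carrier A. \<exists>s\<in>S. x \<otimes>\<^bsub>?L\<^esub> ?h s = ?h a" using as by blast
  next
    fix a assume "a \<in> carrier A"
    then show "?h a \<in> carrier ?L" unfolding carr using S.one_closed by blast
  next
    show "inj_on ?h (carrier A)" by (auto simp: inj_on_def h_eq)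
  qed (use assms(1,6) SC h_Units atom_good mult one zero in \<open>auto simp: good_atom_def\<close>)
  show ?thesis by (rule CHFD_A)
qed

end
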